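(* Let $d$ be a positive integer. Let $\gamma_d(t)=\sum_{k=0}^{d}\beta_k t^k$ be a polynomial of degree $d$ ($\beta_d\neq 0$) and let $\sigma_{d+1}(t)=\sum_{k=0}^{d+1}\alpha_k t^k$ be a polynomial of degree less than or equal to $d+1$. The only polynomial sets $\{P_n\}_{n\ge 0}$ which are $d$-orthogonal and also Sheffer polynomial sets are those generated by $$\exp\left[\int_0^t\frac{\gamma_d(s)}{\sigma_{d+1}(s)}\,ds\right]\exp\left[x\int_0^t\frac{1}{\sigma_{d+1}(s)}\,ds\right]=\sum_{n=0}^{\infty}P_n(x)\frac{t^n}{n!}$$ with the conditions $$\alpha_0\,(n\alpha_{d+1}-\beta_d)\neq 0,\qquad n\ge 1.$$ That is, a polynomial set is both $d$-orthogonal and Sheffer if and only if it is generated in this way by some such pair $\gamma_d,\sigma_{d+1}$ satisfying these conditions.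
   Context: $\mathcal P$ is the vector space of polynomials in $x$ with complex coefficients and $\mathcal P'$ is its algebraic dual; $\langle u,f\rangle$ denotes the value of $u\in\mathcal P'$ at $f\in\mathcal P$. A polynomial set is a sequence $\{P_n\}_{n\ge0}$ in $\mathcal P$ with $\deg P_n=n$ for all $n\ge 0$. For a positive integer $d$, a polynomial set $\{P_n\}_{n\ge0}$ is $d$-orthogonal with respect to a $d$-dimensional functional vector $(u_0,\dots,u_{d-1})$, $u_k\in\mathcal P'$, if for every $k\in\{0,1,\dots,d-1\}$ and every integer $n\ge0$: $\langle u_k,P_nP_m\rangle=0$ for all $m>nd+k$, and $\langle u_k,P_nP_{nd+k}\rangle\neq0$. It is called a $d$-orthogonal polynomial set if such a functional vector exists. A polynomial set $\{P_n\}_{n\ge0}$ is a Sheffer polynomial set if and only if it has a generating function of the form $A(t)e^{xH(t)}=\sum_{n\ge0}P_n(x)\frac{t^n}{n!}$, where $A(t)=\sum_{k\ge0}a_kt^k$ with $a_0\ne0$ and $H(t)=\sum_{k\ge0}h_kt^{k+1}$ with $h_0\neq0$. Generating function identities are read as identities of power series in $t$; since $\alpha_0\neq 0$, the quotients $1/\sigma_{d+1}$ and $\gamma_d/\sigma_{d+1}$ are power series at $0$.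
   Formalization: The displayed generating function forces P_0 = 1, so "only if" fails for e.g. twice the Hermite polynomials; the equivalence is proved for sets with P_0 = 1, and for arbitrary polynomial sets up to a nonzero constant factor c on the generating function. *)

theory Defs
  imports Complex_Main "HOL-Computational_Algebra.Computational_Algebra"
begin

text \<open>
  The condition \<open>P n \<noteq> 0\<close> only matters for \<open>n = 0\<close>: in the library the zero polynomial has
  degree 0, whereas here degree 0 means a nonzero constant.
\<close>
definition polynomial_set :: "(nat \<Rightarrow> complex poly) \<Rightarrow> bool" where
  "polynomial_set P \<longleftrightarrow> (\<forall>n. P n \<noteq> 0 \<and> degree (P n) = n)"

text \<open>Elements of the algebraic dual of the space of complex polynomials.\<close>
abbreviation poly_functional :: "(complex poly \<Rightarrow> complex) \<Rightarrow> bool" where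
  "poly_functional u \<equiv> Vector_Spaces.linear smult (*) u"

text \<open>Only \<open>u 0, \<dots>, u (d - 1)\<close> are relevant in the functional vector \<open>u\<close>.\<close>
definition d_orthogonal_wrt ::
  "nat \<Rightarrow> (nat \<Rightarrow> complex poly \<Rightarrow> complex) \<Rightarrow> (nat \<Rightarrow> complex poly) \<Rightarrow> bool" where
  "d_orthogonal_wrt d u P \<longleftrightarrow>
     (\<forall>k<d. \<forall>n. (\<forall>m. m > n * d + k \<longrightarrow> u k (P n * P m) = 0) \<and>
                u k (P n * P (n * d + k)) \<noteq> 0)"

definition d_orthogonal :: "nat \<Rightarrow> (nat \<Rightarrow> complex poly) \<Rightarrow> bool" where
  "d_orthogonal d P \<longleftrightarrow>
     (\<exists>u. (\<forall>k<d. poly_functional (u k)) \<and> d_orthogonal_wrt d u P)"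

text \<open>
  Identities between power series in \<open>t\<close> whose coefficients are polynomials in \<open>x\<close> are stated
  as identities of complex formal power series in \<open>t\<close>, one for each complex value of \<open>x\<close>.
\<close>
definition egf :: "(nat \<Rightarrow> complex poly) \<Rightarrow> complex \<Rightarrow> complex fps" where
  "egf P x = Abs_fps (\<lambda>n. poly (P n) x / fact n)"

text \<open>
  The exponential of a power series; meaningful for zero constant term, which is the only case
  in which it is used below.
\<close>
abbreviation exp_fps :: "complex fps \<Rightarrow> complex fps" where
  "exp_fps f \<equiv> fps_exp 1 oo f"

definition sheffer :: "(nat \<Rightarrow> complex poly) \<Rightarrow> bool" where
  "sheffer P \<longleftrightarrow>
     (\<exists>A H. fps_nth A 0 \<noteq> 0 \<and> fps_nth H 0 = 0 \<and> fps_nth H 1 \<noteq> 0 \<and>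
            (\<forall>x. A * exp_fps (fps_const x * H) = egf P x))"

text \<open>
  \<open>\<gamma>\<close> and \<open>\<sigma>\<close> are the polynomials \<open>\<gamma>\<^sub>d\<close> and \<open>\<sigma>\<^sub>d\<^sub>+\<^sub>1\<close>, with coefficients \<open>\<beta>\<^sub>k\<close> and \<open>\<alpha>\<^sub>k\<close>.
\<close>
definition admissible_pair :: "nat \<Rightarrow> complex poly \<Rightarrow> complex poly \<Rightarrow> bool" where
  "admissible_pair d \<gamma> \<sigma> \<longleftrightarrow>
     degree \<gamma> = d \<and> coeff \<gamma> d \<noteq> 0 \<and> degree \<sigma> \<le> d + 1 \<and>
     (\<forall>n\<ge>1. coeff \<sigma> 0 * (of_nat n * coeff \<sigma> (d + 1) - coeff \<gamma> d) \<noteq> 0)"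

text \<open>
  For an admissible pair this series has constant term 1 in \<open>t\<close>, so a polynomial set generated by
  it satisfies \<open>P 0 = 1\<close>; \<open>d\<close>-orthogonal and Sheffer polynomial sets in general are only determined
  up to a nonzero constant factor.
\<close>
definition pair_genfun :: "complex poly \<Rightarrow> complex poly \<Rightarrow> complex \<Rightarrow> complex fps" where
  "pair_genfun \<gamma> \<sigma> x =
     exp_fps (fps_integral0 (fps_of_poly \<gamma> / fps_of_poly \<sigma>)) *
     exp_fps (fps_const x * fps_integral0 (1 / fps_of_poly \<sigma>))"

end

theory Submission imports Defs begin

text \<open>
  The proof compares two descriptions of multiplication by \<open>x\<close> in the basis \<open>P\<close>.

  For a Sheffer set with generating function \<open>G = A(t) exp (x H(t))\<close>, logarithmic differentiation
  gives \<open>G' = (A'/A + x H') G\<close>. Put \<open>s = 1/H'\<close> and \<open>g = A'/(A H')\<close>; then \<open>s G' = (g + x) G\<close>. Comparing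
  coefficients of \<open>t\<^sup>n\<close> expresses \<open>x P\<^sub>n\<close> in \<open>P\<^sub>0, \<dots>, P\<^sub>n\<^sub>+\<^sub>1\<close>. Up to a nonzero factor, the coefficient
  of \<open>P\<^sub>j\<close> for \<open>j = n - i\<close>, \<open>i \<ge> 0\<close>, is \<open>j s\<^sub>i\<^sub>+\<^sub>1 - g\<^sub>i\<close> (\<open>egf_ode_imp_mult_X_matrix\<close>).

  On the other side, in analogy with Favard's theorem, \<open>P\<close> is \<open>d\<close>-orthogonal exactly when
  \<open>x P\<^sub>n\<close> involves no \<open>P\<^sub>j\<close> with \<open>j < n - d\<close> and does involve \<open>P\<^sub>n\<^sub>-\<^sub>d\<close> for every \<open>n \<ge> d\<close>
  (\<open>d_orthogonal_iff_band\<close>).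

  Together: \<open>j s\<^sub>i\<^sub>+\<^sub>1 = g\<^sub>i\<close> for all \<open>j\<close> and all \<open>i > d\<close>. Both sides must vanish, since the left one is
  linear in \<open>j\<close> and the right one constant. So \<open>g\<close> and \<open>s\<close> are polynomials \<open>\<gamma>\<close> and \<open>\<sigma>\<close> of degree at most
  \<open>d\<close> and \<open>d + 1\<close>. The outermost diagonal \<open>i = d\<close> gives \<open>j \<alpha>\<^sub>d\<^sub>+\<^sub>1 - \<beta>\<^sub>d \<noteq> 0\<close> for all \<open>j \<ge> 0\<close>, where \<open>j = 0\<close>
  says that \<open>\<gamma>\<close> has degree exactly \<open>d\<close>. Solving \<open>H' = 1/\<sigma>\<close> and \<open>A'/A = \<gamma>/\<sigma>\<close> recovers the stated generating
  function up to the factor \<open>A(0)\<close>, and every step can be reversed.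
\<close>

section \<open>Multiplication by x and d-orthogonality\<close>

definition mult_X_matrix :: "(nat \<Rightarrow> complex poly) \<Rightarrow> (nat \<Rightarrow> nat \<Rightarrow> complex) \<Rightarrow> bool" where
  "mult_X_matrix P c \<longleftrightarrow> (\<forall>n. [:0, 1:] * P n = (\<Sum>j\<le>n + 1. smult (c n j) (P j)))"

text \<open>
  Otherwise \<open>x P\<^sub>n\<close>, which has degree \<open>n + 1\<close>, would be a combination of polynomials of degree
  at most \<open>n\<close>.
\<close>
lemma mult_X_matrix_superdiagonal:
  assumes P: "polynomial_set P" and c: "mult_X_matrix P c"
  shows "c n (n + 1) \<noteq> 0"
proof
  assume "c n (n + 1) = 0"
  hence eq: "[:0, 1:] * P n = (\<Sum>j\<le>n. smult (c n j) (P j))"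
    using c by (simp add: mult_X_matrix_def)
  have "degree (\<Sum>j\<le>n. smult (c n j) (P j)) \<le> n"
    using P by (intro degree_sum_le) (auto simp: polynomial_set_def)
  moreover have "degree ([:0, 1:] * P n) = n + 1"
    using P by (subst degree_mult_eq) (auto simp: polynomial_set_def)
  ultimately show False unfolding eq by simp
qed

lemma vector_space_poly: "vector_space (smult :: 'a::field \<Rightarrow> 'a poly \<Rightarrow> 'a poly)"
  by unfold_locales (auto simp: smult_add_left smult_add_right)

lemma poly_functional_sum_smult:
  assumes "poly_functional u"
  shows "u (\<Sum>j\<in>A. smult (a j) (f j)) = (\<Sum>j\<in>A. a j * u (f j))"
proof -
  interpret Vector_Spaces.linear smult "(*)" u by (fact assms)
  show ?thesis by (simp add: sum scale)
qed

lemma poly_functional_add_smult: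
  assumes "poly_functional u"
  shows "u (smult a f + g) = a * u f + u g"
proof -
  interpret Vector_Spaces.linear smult "(*)" u by (fact assms)
  show ?thesis by (simp add: add scale)
qed

text \<open>
  The polynomials \<open>P\<^sub>j\<close> are linearly independent because their degrees are distinct, so a functional may be
  prescribed freely on them. These coordinate functionals are the ones that witness
  \<open>d\<close>-orthogonality below.
\<close>
lemma polynomial_set_dual_basis:
  assumes P: "polynomial_set P"
  shows "\<exists>u. poly_functional u \<and> (\<forall>j. u (P j) = (if j = k then 1 else 0))"
proof -
  interpret V: vector_space "smult :: complex \<Rightarrow> complex poly \<Rightarrow> complex poly"
    by (rule vector_space_poly)
  interpret W: vector_space_pair "smult :: complex \<Rightarrow> complex poly \<Rightarrow> complex poly"
      "(*) :: complex \<Rightarrow> complex \<Rightarrow> complex"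
    by unfold_locales (auto simp: algebra_simps)
  have P_degree: "P (degree v) = v" if "v \<in> range P" for v
    using that P by (auto simp: polynomial_set_def)
  have "V.independent (range P)"
    unfolding V.independent_explicit_module
  proof (intro allI impI, rule ccontr)
    fix t r v
    assume t: "finite t" "t \<subseteq> range P" "(\<Sum>v\<in>t. smult (r v) v) = 0" "v \<in> t" "r v \<noteq> 0"
    \<comment> \<open>The element of largest degree with nonzero coefficient cannot be cancelled by the others.\<close>
    define S where "S = {v \<in> t. r v \<noteq> 0}"
    have "finite S" "S \<noteq> {}" using t by (auto simp: S_def)
    hence "Max (degree ` S) \<in> degree ` S" by (intro Max_in) auto
    then obtain w where w: "w \<in> S" "degree w = Max (degree ` S)" by auto
    have le: "degree v \<le> degree w" if "v \<in> S" for v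
      using that \<open>finite S\<close> w by simp
    have "coeff (smult (r v) v) (degree w) = 0" if "v \<in> t" "v \<noteq> w" for v
    proof (cases "v \<in> S")
      case True
      have "degree v \<noteq> degree w"
        using P_degree[of v] P_degree[of w] that w(1) t(2) unfolding S_def by fastforce
      with le[OF True] show ?thesis by (simp add: coeff_eq_0)
    qed (use that in \<open>auto simp: S_def\<close>)
    hence "(\<Sum>v\<in>t. coeff (smult (r v) v) (degree w)) = (\<Sum>v\<in>{w}. coeff (smult (r v) v) (degree w))"
      using t w by (intro sum.mono_neutral_right) (auto simp: S_def)
    moreover have "(\<Sum>v\<in>t. coeff (smult (r v) v) (degree w)) = 0"
      using t(3) by (metis coeff_0 coeff_sum)
    moreover have "w \<noteq> 0" using w(1) t(2) P by (auto simp: S_def polynomial_set_def)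
    hence "r w * coeff w (degree w) \<noteq> 0" using w(1) by (simp add: S_def)
    ultimately show False by simp
  qed
  from W.linear_independent_extend[OF this, of "\<lambda>v. if v = P k then 1 else 0"]
  obtain u where u: "poly_functional u" "\<forall>v\<in>range P. u v = (if v = P k then 1 else 0)"
    by blast
  have "P j = P k \<longleftrightarrow> j = k" for j
    using P by (metis polynomial_set_def)
  with u show ?thesis by auto
qed

text \<open>
  For \<open>j = m d + k\<close> with \<open>k < d\<close>, the number \<open>u\<^sub>k (x P\<^sub>m P\<^sub>n)\<close> is evaluated in two ways. Expanding \<open>x P\<^sub>n\<close>,
  all terms beyond \<open>P\<^sub>j\<close> are killed by orthogonality, and those before \<open>P\<^sub>j\<close> by induction on \<open>j\<close>, so
  \<open>c n j * u\<^sub>k (P\<^sub>m P\<^sub>j)\<close> remains, with a nonzero second factor. Expanding \<open>x P\<^sub>m\<close> instead leaves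
  \<open>u\<^sub>k (P\<^sub>m\<^sub>+\<^sub>1 P\<^sub>n)\<close> up to a nonzero factor, and this is zero for \<open>n > j + d\<close> and nonzero for
  \<open>n = j + d\<close>.
\<close>
lemma d_orthogonal_imp_band:
  assumes P: "polynomial_set P" and c: "mult_X_matrix P c" and d: "d > 0"
    and orth: "d_orthogonal d P"
  shows "j + d < n \<Longrightarrow> c n j = 0" and "c (j + d) j \<noteq> 0"
proof -
  obtain u where lin: "\<And>k. k < d \<Longrightarrow> poly_functional (u k)"
    and zero: "\<And>k n m. k < d \<Longrightarrow> m > n * d + k \<Longrightarrow> u k (P n * P m) = 0"
    and nonzero: "\<And>k n. k < d \<Longrightarrow> u k (P n * P (n * d + k)) \<noteq> 0"
    using orth unfolding d_orthogonal_def d_orthogonal_wrt_def by blast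
  have below: "u k (P m * ([:0, 1:] * P n)) = c n j * u k (P m * P j)"
    if k: "k < d" and j: "j = m * d + k" "j \<le> n" and IH: "\<And>i. i < j \<Longrightarrow> c n i = 0" for k m j n
  proof -
    have "u k (P m * ([:0, 1:] * P n)) = u k (\<Sum>i\<le>n + 1. smult (c n i) (P m * P i))"
      using c by (simp add: mult_X_matrix_def sum_distrib_left del: mult_pCons_left sum.atMost_Suc)
    also have "\<dots> = (\<Sum>i\<le>n + 1. c n i * u k (P m * P i))"
      by (rule poly_functional_sum_smult[OF lin[OF k]])
    also have "\<dots> = (\<Sum>i\<in>{j}. c n i * u k (P m * P i))"
    proof (rule sum.mono_neutral_right)
      show "\<forall>i\<in>{..n + 1} - {j}. c n i * u k (P m * P i) = 0"
      proof
        fix i assume "i \<in> {..n + 1} - {j}"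
        hence "i < j \<or> i > j" by auto
        thus "c n i * u k (P m * P i) = 0" using IH zero[OF k, of m i] j by auto
      qed
    qed (use j in auto)
    finally show ?thesis by simp
  qed
  have above: "u k (P m * ([:0, 1:] * P n)) = c m (m + 1) * u k (P (m + 1) * P n)"
    if k: "k < d" and n: "m * d + k + d \<le> n" for k m n
  proof -
    have "P m * ([:0, 1:] * P n) = ([:0, 1:] * P m) * P n"
      by (simp only: mult_ac)
    also have "\<dots> = (\<Sum>i\<le>m + 1. smult (c m i) (P i * P n))"
      using c by (simp add: mult_X_matrix_def sum_distrib_right del: mult_pCons_left sum.atMost_Suc)
    finally have "u k (P m * ([:0, 1:] * P n)) = (\<Sum>i\<le>m + 1. c m i * u k (P i * P n))"
      using poly_functional_sum_smult[OF lin[OF k]] by metis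
    also have "\<dots> = (\<Sum>i\<in>{m + 1}. c m i * u k (P i * P n))"
    proof (rule sum.mono_neutral_right)
      show "\<forall>i\<in>{..m + 1} - {m + 1}. c m i * u k (P i * P n) = 0"
      proof
        fix i assume "i \<in> {..m + 1} - {m + 1}"
        hence "i * d \<le> m * d" by simp
        hence "i * d + k < n" using n d by linarith
        thus "c m i * u k (P i * P n) = 0" using zero[OF k] by simp
      qed
    qed auto
    finally show ?thesis by simp
  qed
  have decomp: "j = (j div d) * d + j mod d" "j mod d < d" for j
    using d by auto
  have band: "c n j = 0" if "j + d < n" for j n
    using that
  proof (induction j rule: less_induct)
    case (less j)
    define m k where "m = j div d" and "k = j mod d"
    have mk: "j = m * d + k" "k < d" using decomp by (auto simp: m_def k_def)
    have "c n j * u k (P m * P j) = c m (m + 1) * u k (P (m + 1) * P n)"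
      using below[of k j m n] above[of k m n] mk less by auto
    also have "\<dots> = 0" using zero[of k "m + 1" n] mk less.prems by simp
    finally show ?case using nonzero[of k m] mk by simp
  qed
  show "j + d < n \<Longrightarrow> c n j = 0" by (rule band)
  define m k where "m = j div d" and "k = j mod d"
  have mk: "j = m * d + k" "k < d" using decomp by (auto simp: m_def k_def)
  have "c (j + d) j * u k (P m * P j) = c m (m + 1) * u k (P (m + 1) * P (j + d))"
    using below[of k j m "j + d"] above[of k m "j + d"] mk band by auto
  moreover have "j + d = (m + 1) * d + k" using mk by simp
  hence "u k (P (m + 1) * P (j + d)) \<noteq> 0" using nonzero[of k "m + 1"] mk by metis
  ultimately show "c (j + d) j \<noteq> 0"
    using mult_X_matrix_superdiagonal[OF P c, of m] by auto
qed

text \<open>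
  Multiplication by \<open>x\<close> lowers the smallest index that occurs in an expansion in the \<open>P\<^sub>j\<close> by at most \<open>d\<close>, and
  it lowers it by exactly \<open>d\<close> as long as the index stays nonnegative. Hence, for \<open>f \<noteq> 0\<close> of degree \<open>n\<close>, the
  smallest index in \<open>f P\<^sub>m\<close> is \<open>m - n d\<close> when \<open>m \<ge> n d\<close>. Read off with the coordinate functional of \<open>P\<^sub>k\<close>,
  this is the claim. Induction on \<open>f\<close> requires it for all polynomials, not only for the \<open>P\<^sub>n\<close>.
\<close>
lemma band_dual_functional:
  assumes c: "mult_X_matrix P c" and d: "d > 0"
    and band: "\<And>n j. j + d < n \<Longrightarrow> c n j = 0" and edge: "\<And>j. c (j + d) j \<noteq> 0"
    and lin: "poly_functional u" and dual: "\<And>j. u (P j) = (if j = k then 1 else 0)"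
  shows "(\<forall>m > degree f * d + k. u (f * P m) = 0) \<and>
         (f \<noteq> 0 \<longrightarrow> u (f * P (degree f * d + k)) \<noteq> 0)"
proof (induction f rule: pCons_induct)
  case 0
  have "u 0 = 0" using poly_functional_sum_smult[OF lin, of _ _ "{}"] by simp
  thus ?case by simp
next
  case (pCons a f)
  show ?case
  proof (cases "f = 0")
    case True
    have "u (smult a (P m)) = a * u (P m)" for m
      using poly_functional_sum_smult[OF lin, of "\<lambda>_. a" P "{m}"] by simp
    with True pCons.hyps dual show ?thesis by simp
  next
    case False
    let ?e = "degree f"
    \<comment> \<open>Writing \<open>pCons a f = a + x f\<close>, the factor \<open>x\<close> is moved over to \<open>P m\<close> and expanded there.\<close>
    have step: "u (pCons a f * P m) = (if m = (?e + 1) * d + k then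
        c m (m - d) * u (f * P (m - d)) else 0)" if m: "m \<ge> (?e + 1) * d + k" for m
    proof -
      have "pCons a f * P m = smult a (P m) + f * ([:0, 1:] * P m)" by simp
      also have "f * ([:0, 1:] * P m) = (\<Sum>j\<le>m + 1. smult (c m j) (f * P j))"
        using c by (simp add: mult_X_matrix_def sum_distrib_left del: mult_pCons_left sum.atMost_Suc)
      finally have "u (pCons a f * P m) = a * u (P m) + (\<Sum>j\<le>m + 1. c m j * u (f * P j))"
        by (simp only: poly_functional_add_smult[OF lin] poly_functional_sum_smult[OF lin])
      moreover have "u (P m) = 0" using m d dual by auto
      moreover have "(\<Sum>j\<le>m + 1. c m j * u (f * P j)) = (\<Sum>j\<in>{m - d}. c m j * u (f * P j))"
      proof (rule sum.mono_neutral_right)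
        show "\<forall>j\<in>{..m + 1} - {m - d}. c m j * u (f * P j) = 0"
        proof
          fix j assume "j \<in> {..m + 1} - {m - d}"
          hence "j + d < m \<or> j > ?e * d + k" using m by auto
          thus "c m j * u (f * P j) = 0" using band[of j m] pCons.IH by auto
        qed
      qed auto
      moreover have "u (f * P (m - d)) = 0" if "m \<noteq> (?e + 1) * d + k"
        using that m pCons.IH by auto
      ultimately show ?thesis by simp
    qed
    have "c ((?e + 1) * d + k) ((?e + 1) * d + k - d) \<noteq> 0"
      using edge[of "?e * d + k"] by (simp add: algebra_simps)
    with step False pCons.IH show ?thesis by simp
  qed
qed

text \<open>
  The analogue of Favard's theorem for \<open>d\<close>-orthogonality. The coefficients \<open>c\<close> form a lower
  Hessenberg matrix; \<open>d\<close>-orthogonality says that it has exactly \<open>d\<close> subdiagonals, the last of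
  which has no zero entry.
\<close>
lemma d_orthogonal_iff_band:
  assumes P: "polynomial_set P" and c: "mult_X_matrix P c" and d: "d > 0"
  shows "d_orthogonal d P \<longleftrightarrow>
    (\<forall>n j. j + d < n \<longrightarrow> c n j = 0) \<and> (\<forall>j. c (j + d) j \<noteq> 0)"
proof
  assume "d_orthogonal d P"
  thus "(\<forall>n j. j + d < n \<longrightarrow> c n j = 0) \<and> (\<forall>j. c (j + d) j \<noteq> 0)"
    using d_orthogonal_imp_band[OF P c d] by blast
next
  assume band: "(\<forall>n j. j + d < n \<longrightarrow> c n j = 0) \<and> (\<forall>j. c (j + d) j \<noteq> 0)"
  obtain u where u: "\<And>k. poly_functional (u k)" "\<And>k j. u k (P j) = (if j = k then 1 else 0)"
    using polynomial_set_dual_basis[OF P] by metis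
  have "d_orthogonal_wrt d u P"
    unfolding d_orthogonal_wrt_def
  proof (intro allI impI)
    fix k n :: nat
    have "P n \<noteq> 0" "degree (P n) = n" using P by (auto simp: polynomial_set_def)
    thus "(\<forall>m. m > n * d + k \<longrightarrow> u k (P n * P m) = 0) \<and> u k (P n * P (n * d + k)) \<noteq> 0"
      using band_dual_functional[OF c d _ _ u(1) u(2), of "P n" k] band by simp
  qed
  with u(1) show "d_orthogonal d P" by (auto simp: d_orthogonal_def)
qed

section \<open>The differential equation of a Sheffer generating function\<close>

definition egf_ode :: "complex fps \<Rightarrow> complex fps \<Rightarrow> (nat \<Rightarrow> complex poly) \<Rightarrow> bool" where
  "egf_ode s g P \<longleftrightarrow> (\<forall>x. s * fps_deriv (egf P x) = (g + fps_const x) * egf P x)"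

text \<open>
  The entries result from comparing coefficients of \<open>t\<^sup>n\<close> in the differential equation; the quotient of
  factorials undoes the normalisation of the exponential generating function.
\<close>
definition ode_matrix :: "complex fps \<Rightarrow> complex fps \<Rightarrow> nat \<Rightarrow> nat \<Rightarrow> complex" where
  "ode_matrix s g n j = fact n / fact j *
     (of_nat j * fps_nth s (n + 1 - j) - (if j \<le> n then fps_nth g (n - j) else 0))"

lemma egf_ode_imp_mult_X_matrix:
  assumes ode: "egf_ode s g P"
  shows "mult_X_matrix P (ode_matrix s g)"
  unfolding mult_X_matrix_def
proof (intro allI)
  fix n
  show "[:0, 1:] * P n = (\<Sum>j\<le>n + 1. smult (ode_matrix s g n j) (P j))"
  proof (rule poly_ext)
    fix x
    let ?q = "\<lambda>j. poly (P j) x / fact j"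
    have "fps_nth (fps_deriv (egf P x) * s) n = (\<Sum>i\<le>n. of_nat (i + 1) * ?q (i + 1) * fps_nth s (n - i))"
      by (simp add: fps_mult_nth egf_def atLeast0AtMost)
    also have "\<dots> = (\<Sum>j\<le>n + 1. of_nat j * fps_nth s (n + 1 - j) * ?q j)"
      by (simp add: sum.atMost_Suc_shift mult_ac del: sum.atMost_Suc of_nat_Suc fact_Suc)
    finally have L: "fps_nth (s * fps_deriv (egf P x)) n = \<dots>"
      by (simp add: mult.commute)
    have "fps_nth (egf P x * g) n = (\<Sum>j\<le>n. ?q j * fps_nth g (n - j))"
      by (simp add: fps_mult_nth egf_def atLeast0AtMost)
    also have "\<dots> = (\<Sum>j\<le>n + 1. (if j \<le> n then fps_nth g (n - j) else 0) * ?q j)"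
      by (simp add: mult_ac)
    finally have R: "fps_nth (g * egf P x) n = \<dots>"
      by (simp add: mult.commute)
    have "fps_nth (s * fps_deriv (egf P x)) n = fps_nth (g * egf P x) n + x * ?q n"
      using ode by (simp add: egf_ode_def distrib_right egf_def)
    hence "x * ?q n = (\<Sum>j\<le>n + 1. (of_nat j * fps_nth s (n + 1 - j)
        - (if j \<le> n then fps_nth g (n - j) else 0)) * ?q j)"
      unfolding L R by (simp only: left_diff_distrib sum_subtractf) (simp only: algebra_simps)
    hence "x * poly (P n) x = fact n * (\<Sum>j\<le>n + 1. (of_nat j * fps_nth s (n + 1 - j)
        - (if j \<le> n then fps_nth g (n - j) else 0)) * ?q j)"
      by (simp add: field_simps del: sum.atMost_Suc fact_Suc)
    also have "\<dots> = (\<Sum>j\<le>n + 1. ode_matrix s g n j * poly (P j) x)"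
      unfolding sum_distrib_left ode_matrix_def by (intro sum.cong refl) simp
    finally show "poly ([:0, 1:] * P n) x = poly (\<Sum>j\<le>n + 1. smult (ode_matrix s g n j) (P j)) x"
      by (simp add: poly_sum del: sum.atMost_Suc)
  qed
qed

text \<open>
  On the \<open>i\<close>-th subdiagonal, the entry in column \<open>j\<close> vanishes iff \<open>j s\<^sub>i\<^sub>+\<^sub>1 = g\<^sub>i\<close>. For this to hold for all
  \<open>j\<close>, both coefficients must be zero, as \<open>j = 0\<close> and \<open>j = 1\<close> show.
\<close>
lemma egf_ode_d_orthogonal_iff:
  assumes P: "polynomial_set P" and d: "d > 0" and ode: "egf_ode s g P"
  shows "d_orthogonal d P \<longleftrightarrow>
    (\<forall>i>d. fps_nth g i = 0 \<and> fps_nth s (i + 1) = 0) \<and>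
    (\<forall>n. of_nat n * fps_nth s (d + 1) - fps_nth g d \<noteq> 0)"
proof -
  have entry: "ode_matrix s g (j + i) j = 0 \<longleftrightarrow> of_nat j * fps_nth s (i + 1) = fps_nth g i" for i j
    by (simp add: ode_matrix_def)
  have "(\<forall>n j. j + d < n \<longrightarrow> ode_matrix s g n j = 0) \<longleftrightarrow>
      (\<forall>i>d. \<forall>j. ode_matrix s g (j + i) j = 0)"
    by (auto simp: less_iff_Suc_add add_ac) (metis add.assoc add.commute add_Suc_right)
  also have "\<dots> \<longleftrightarrow> (\<forall>i>d. \<forall>j. of_nat j * fps_nth s (i + 1) = fps_nth g i)"
    by (simp only: entry)
  also have "\<dots> \<longleftrightarrow> (\<forall>i>d. fps_nth g i = 0 \<and> fps_nth s (i + 1) = 0)"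
  proof -
    have "(\<forall>j. of_nat j * b = a) \<longleftrightarrow> a = 0 \<and> b = 0" for a b :: complex
      by (metis mult_zero_left mult_zero_right mult_1 of_nat_0 of_nat_1)
    thus ?thesis by simp
  qed
  finally show ?thesis
    unfolding d_orthogonal_iff_band[OF P egf_ode_imp_mult_X_matrix[OF ode] d] entry by simp
qed

lemma fps_deriv_exp_fps:
  assumes "fps_nth f 0 = 0"
  shows "fps_deriv (exp_fps f) = fps_deriv f * exp_fps f"
  using assms by (simp add: fps_compose_deriv)

text \<open>
  This is \<open>G' = (A'/A + x H') G\<close> divided by \<open>H'\<close>, which is invertible because \<open>H'(0) \<noteq> 0\<close>.
\<close>
lemma sheffer_form_ode:
  assumes A: "fps_nth A 0 \<noteq> 0" and H: "fps_nth H 0 = 0" "fps_nth H 1 \<noteq> 0"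
    and gen: "\<forall>x. A * exp_fps (fps_const x * H) = egf P x"
  shows "egf_ode (inverse (fps_deriv H)) (fps_deriv A / A / fps_deriv H) P"
  unfolding egf_ode_def
proof
  fix x
  let ?E = "exp_fps (fps_const x * H)"
  have "fps_deriv (egf P x) = fps_deriv (A * ?E)" using gen by simp
  also have "\<dots> = A * (fps_const x * fps_deriv H * ?E) + fps_deriv A * ?E"
    using fps_deriv_exp_fps[of "fps_const x * H"] H by (simp only: fps_deriv_mult) simp
  also have "fps_deriv A = fps_deriv A / A * A"
    using A by (simp add: fps_divide_unit mult.assoc inverse_mult_eq_1)
  also have "A * (fps_const x * fps_deriv H * ?E) + fps_deriv A / A * A * ?E
      = (fps_deriv A / A + fps_const x * fps_deriv H) * egf P x"
    using gen[rule_format, of x, symmetric] by (simp add: algebra_simps)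
  finally have "inverse (fps_deriv H) * fps_deriv (egf P x) =
      (inverse (fps_deriv H) * (fps_deriv A / A) + fps_const x * (inverse (fps_deriv H) * fps_deriv H)) * egf P x"
    by (simp add: algebra_simps)
  thus "inverse (fps_deriv H) * fps_deriv (egf P x) =
      (fps_deriv A / A / fps_deriv H + fps_const x) * egf P x"
    using H by (simp add: inverse_mult_eq_1 inverse_mult_eq_1' fps_divide_unit mult_ac)
qed

section \<open>Solving the differential equation\<close>

text \<open>
  The quotient of two solutions of \<open>A' = q A\<close>, the second with nonzero constant term, has
  derivative zero.
\<close>
lemma fps_deriv_determines_exp:
  fixes A q :: "complex fps"
  assumes "fps_deriv A = q * A"
  shows "A = fps_const (fps_nth A 0) * exp_fps (fps_integral0 q)"
proof -
  let ?E = "exp_fps (fps_integral0 q)"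
  have E0: "fps_nth ?E 0 = 1" by simp
  have E': "fps_deriv ?E = q * ?E" by (subst fps_deriv_exp_fps) (simp_all add: fps_deriv_fps_integral)
  have "fps_deriv (A * inverse ?E) = A * (- (q * ?E) * (inverse ?E)\<^sup>2) + q * A * inverse ?E"
    using E0 E' assms by (simp only: fps_deriv_mult fps_inverse_deriv) (simp add: fps_inverse_deriv)
  also have "\<dots> = q * A * inverse ?E * (1 - inverse ?E * ?E)"
    by (simp add: algebra_simps power2_eq_square)
  also have "\<dots> = 0" using E0 by (simp add: inverse_mult_eq_1)
  finally have "A * inverse ?E = fps_const (fps_nth (A * inverse ?E) 0)"
    by (rule fps_deriv_eq_0_iff[THEN iffD1])
  hence "A * inverse ?E = fps_const (fps_nth A 0)"
    using E0 by simp
  hence "A * (inverse ?E * ?E) = fps_const (fps_nth A 0) * ?E" by (simp add: mult.assoc[symmetric])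
  thus ?thesis using E0 by (simp add: inverse_mult_eq_1)
qed

text \<open>
  Here \<open>H' = 1/\<sigma>\<close> and \<open>A' = (\<gamma>/\<sigma>) A\<close>. With the initial values \<open>H(0) = 0\<close> and \<open>A(0)\<close> these equations
  determine \<open>H\<close> and \<open>A\<close>.
\<close>
lemma sheffer_form_eq_pair_genfun:
  assumes A: "fps_nth A 0 \<noteq> 0" and H: "fps_nth H 0 = 0" "fps_nth H 1 \<noteq> 0"
    and \<sigma>: "fps_of_poly \<sigma> = inverse (fps_deriv H)"
    and \<gamma>: "fps_of_poly \<gamma> = fps_deriv A / A / fps_deriv H"
  shows "A * exp_fps (fps_const x * H) = fps_const (fps_nth A 0) * pair_genfun \<gamma> \<sigma> x"
proof -
  have D: "fps_nth (fps_deriv H) 0 \<noteq> 0" using H by simp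
  have S: "fps_nth (inverse (fps_deriv H)) 0 \<noteq> 0" using D by simp
  have "1 / fps_of_poly \<sigma> = fps_deriv H"
    using D S by (simp add: \<sigma> fps_divide_unit fps_inverse_idempotent)
  hence intH: "fps_integral0 (1 / fps_of_poly \<sigma>) = H"
    using H by (simp add: fps_integral0_deriv)
  have "fps_of_poly \<gamma> / fps_of_poly \<sigma> = fps_deriv A / A * (inverse (fps_deriv H) * fps_deriv H)"
    using D S by (simp add: \<sigma> \<gamma> fps_divide_unit fps_inverse_idempotent mult_ac)
  hence "fps_of_poly \<gamma> / fps_of_poly \<sigma> = fps_deriv A / A"
    using D by (simp add: inverse_mult_eq_1)
  moreover have "fps_deriv A = fps_deriv A / A * A"
    using A by (simp add: fps_divide_unit mult.assoc inverse_mult_eq_1)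
  ultimately have "A = fps_const (fps_nth A 0) * exp_fps (fps_integral0 (fps_of_poly \<gamma> / fps_of_poly \<sigma>))"
    using fps_deriv_determines_exp by simp
  thus ?thesis unfolding pair_genfun_def intH by (metis mult.assoc)
qed

text \<open>
  The converse passage: \<open>A = c exp \<integral>\<gamma>/\<sigma>\<close> and \<open>H = \<integral>1/\<sigma>\<close> satisfy \<open>1/H' = \<sigma>\<close> and \<open>A'/(A H') = \<gamma>\<close>, so the
  series in the differential equation are the given polynomials.
\<close>
lemma pair_genfun_sheffer_form:
  assumes c: "c \<noteq> 0" and \<sigma>: "coeff \<sigma> 0 \<noteq> 0"
    and gen: "\<forall>x. fps_const c * pair_genfun \<gamma> \<sigma> x = egf P x"
  shows "sheffer P" and "egf_ode (fps_of_poly \<sigma>) (fps_of_poly \<gamma>) P"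
proof -
  define A where "A = fps_const c * exp_fps (fps_integral0 (fps_of_poly \<gamma> / fps_of_poly \<sigma>))"
  define H where "H = fps_integral0 (1 / fps_of_poly \<sigma>)"
  have A0: "fps_nth A 0 \<noteq> 0" using c by (simp add: A_def)
  have H': "fps_deriv H = inverse (fps_of_poly \<sigma>)"
    using \<sigma> by (simp add: H_def fps_deriv_fps_integral fps_divide_unit)
  have H0: "fps_nth H 0 = 0" by (simp add: H_def)
  have H1: "fps_nth H 1 \<noteq> 0"
    using arg_cong[OF H', of "\<lambda>f. fps_nth f 0"] \<sigma> by simp
  have genAH: "\<forall>x. A * exp_fps (fps_const x * H) = egf P x"
    using gen by (simp add: A_def H_def pair_genfun_def mult.assoc)
  show "sheffer P" unfolding sheffer_def using A0 H0 H1 genAH by blast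
  have "fps_deriv A = fps_of_poly \<gamma> / fps_of_poly \<sigma> * A"
    unfolding A_def by (simp add: fps_deriv_exp_fps fps_deriv_fps_integral mult_ac del: fps_compose_deriv)
  hence "fps_deriv A / A = fps_of_poly \<gamma> / fps_of_poly \<sigma>"
    using A0 by (simp add: fps_divide_unit mult.assoc inverse_mult_eq_1')
  hence "fps_deriv A / A / fps_deriv H = fps_of_poly \<gamma>"
    using \<sigma> by (simp add: H' fps_divide_unit fps_inverse_idempotent mult.assoc inverse_mult_eq_1)
  moreover have "inverse (fps_deriv H) = fps_of_poly \<sigma>"
    using \<sigma> by (simp add: H' fps_inverse_idempotent)
  ultimately show "egf_ode (fps_of_poly \<sigma>) (fps_of_poly \<gamma>) P"
    using sheffer_form_ode[OF A0 H0 H1 genAH] by simp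
qed

lemma fps_of_poly_truncate_fps_eq:
  assumes "\<And>i. i \<ge> n \<Longrightarrow> fps_nth f i = 0"
  shows "fps_of_poly (truncate_fps n f) = f"
  using assms by (auto simp: fps_eq_iff)

section \<open>The classification\<close>

text \<open>
  The form in which admissibility arises from \<open>egf_ode_d_orthogonal_iff\<close>: allowing \<open>n = 0\<close> in the
  nonvanishing condition encodes that the leading coefficient of \<open>\<gamma>\<close> is nonzero.
\<close>
lemma admissible_pair_iff:
  "admissible_pair d \<gamma> \<sigma> \<longleftrightarrow> coeff \<sigma> 0 \<noteq> 0 \<and>
     (\<forall>i>d. coeff \<gamma> i = 0 \<and> coeff \<sigma> (i + 1) = 0) \<and>
     (\<forall>n. of_nat n * coeff \<sigma> (d + 1) - coeff \<gamma> d \<noteq> 0)"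
proof (intro iffI conjI allI impI)
  fix i assume "admissible_pair d \<gamma> \<sigma>" "i > d"
  thus "coeff \<gamma> i = 0" "coeff \<sigma> (i + 1) = 0"
    by (auto simp: admissible_pair_def intro!: coeff_eq_0)
next
  fix n assume "admissible_pair d \<gamma> \<sigma>"
  thus "of_nat n * coeff \<sigma> (d + 1) - coeff \<gamma> d \<noteq> 0"
    by (cases "n = 0") (auto simp: admissible_pair_def)
next
  assume "admissible_pair d \<gamma> \<sigma>"
  thus "coeff \<sigma> 0 \<noteq> 0" by (auto simp: admissible_pair_def)
next
  assume *: "coeff \<sigma> 0 \<noteq> 0 \<and> (\<forall>i>d. coeff \<gamma> i = 0 \<and> coeff \<sigma> (i + 1) = 0) \<and>
     (\<forall>n. of_nat n * coeff \<sigma> (d + 1) - coeff \<gamma> d \<noteq> 0)"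
  hence d: "coeff \<gamma> d \<noteq> 0" by (metis diff_0_right mult_zero_left of_nat_0)
  have "degree \<gamma> = d" using * d by (intro antisym degree_le le_degree) auto
  moreover have "coeff \<sigma> i = 0" if "i > d + 1" for i
    using * that by (metis Suc_eq_plus1 Suc_lessE)
  hence "degree \<sigma> \<le> d + 1" by (intro degree_le) auto
  ultimately show "admissible_pair d \<gamma> \<sigma>" using * d by (auto simp: admissible_pair_def)
qed

lemma d_orthogonal_sheffer_iff:
  assumes d: "d > 0" and P: "polynomial_set P"
  shows "d_orthogonal d P \<and> sheffer P \<longleftrightarrow>
           (\<exists>c \<gamma> \<sigma>. c \<noteq> 0 \<and> admissible_pair d \<gamma> \<sigma> \<and>
              (\<forall>x. fps_const c * pair_genfun \<gamma> \<sigma> x = egf P x))"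
proof
  assume "d_orthogonal d P \<and> sheffer P"
  then obtain A H where orth: "d_orthogonal d P" and A: "fps_nth A 0 \<noteq> 0"
    and H: "fps_nth H 0 = 0" "fps_nth H 1 \<noteq> 0"
    and gen: "\<forall>x. A * exp_fps (fps_const x * H) = egf P x"
    by (auto simp: sheffer_def)
  define s g where "s = inverse (fps_deriv H)" and "g = fps_deriv A / A / fps_deriv H"
  have "egf_ode s g P"
    unfolding s_def g_def by (rule sheffer_form_ode[OF A H gen])
  note coeffs = egf_ode_d_orthogonal_iff[OF P d this, THEN iffD1, OF orth]
  define \<sigma> \<gamma> where "\<sigma> = truncate_fps (d + 2) s" and "\<gamma> = truncate_fps (d + 1) g"
  have "fps_nth s i = 0" if "i \<ge> d + 2" for i
    using coeffs that by (cases i) auto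
  hence \<sigma>: "fps_of_poly \<sigma> = s"
    unfolding \<sigma>_def by (rule fps_of_poly_truncate_fps_eq)
  have \<gamma>: "fps_of_poly \<gamma> = g"
    unfolding \<gamma>_def using coeffs by (intro fps_of_poly_truncate_fps_eq) auto
  have "coeff \<sigma> i = fps_nth s i" "coeff \<gamma> i = fps_nth g i" for i
    by (simp_all flip: \<sigma> \<gamma>)
  moreover have "fps_nth s 0 \<noteq> 0" using H by (simp add: s_def)
  ultimately have "admissible_pair d \<gamma> \<sigma>"
    using coeffs by (simp add: admissible_pair_iff)
  moreover have "fps_const (fps_nth A 0) * pair_genfun \<gamma> \<sigma> x = egf P x" for x
    using sheffer_form_eq_pair_genfun[OF A H \<sigma>[unfolded s_def] \<gamma>[unfolded g_def]] gen by simp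
  ultimately show "\<exists>c \<gamma> \<sigma>. c \<noteq> 0 \<and> admissible_pair d \<gamma> \<sigma> \<and>
      (\<forall>x. fps_const c * pair_genfun \<gamma> \<sigma> x = egf P x)"
    using A by blast
next
  assume "\<exists>c \<gamma> \<sigma>. c \<noteq> 0 \<and> admissible_pair d \<gamma> \<sigma> \<and>
      (\<forall>x. fps_const c * pair_genfun \<gamma> \<sigma> x = egf P x)"
  then obtain c \<gamma> \<sigma> where c: "c \<noteq> 0" and adm: "admissible_pair d \<gamma> \<sigma>"
    and gen: "\<forall>x. fps_const c * pair_genfun \<gamma> \<sigma> x = egf P x" by blast
  have "coeff \<sigma> 0 \<noteq> 0" using adm by (simp add: admissible_pair_iff)
  note form = pair_genfun_sheffer_form[OF c this gen]
  have "d_orthogonal d P"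
    using adm unfolding egf_ode_d_orthogonal_iff[OF P d form(2)]
    by (simp add: admissible_pair_iff)
  with form(1) show "d_orthogonal d P \<and> sheffer P" by simp
qed

theorem theorem2p2:
  fixes d :: nat and P :: "nat \<Rightarrow> complex poly"
  assumes "d > 0" and "polynomial_set P"
  shows "(P 0 = 1 \<longrightarrow>
           (d_orthogonal d P \<and> sheffer P \<longleftrightarrow>
             (\<exists>\<gamma> \<sigma>. admissible_pair d \<gamma> \<sigma> \<and> (\<forall>x. pair_genfun \<gamma> \<sigma> x = egf P x)))) \<and>
         (d_orthogonal d P \<and> sheffer P \<longleftrightarrow>
           (\<exists>c \<gamma> \<sigma>. c \<noteq> 0 \<and> admissible_pair d \<gamma> \<sigma> \<and>
              (\<forall>x. fps_const c * pair_genfun \<gamma> \<sigma> x = egf P x)))"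
proof (rule conjI)
  show iff: "d_orthogonal d P \<and> sheffer P \<longleftrightarrow>
           (\<exists>c \<gamma> \<sigma>. c \<noteq> 0 \<and> admissible_pair d \<gamma> \<sigma> \<and>
              (\<forall>x. fps_const c * pair_genfun \<gamma> \<sigma> x = egf P x))"
    by (rule d_orthogonal_sheffer_iff[OF assms])
  \<comment> \<open>The generating function of a pair has constant term 1 in \<open>t\<close>, so \<open>c\<close> is the constant polynomial \<open>P 0\<close>.\<close>
  have c_eq: "c = poly (P 0) 0" if "\<forall>x. fps_const c * pair_genfun \<gamma> \<sigma> x = egf P x" for c \<gamma> \<sigma>
    using arg_cong[OF that[rule_format, of 0], of "\<lambda>f. fps_nth f 0"]
    by (simp add: pair_genfun_def egf_def)
  show "P 0 = 1 \<longrightarrow>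
           (d_orthogonal d P \<and> sheffer P \<longleftrightarrow>
             (\<exists>\<gamma> \<sigma>. admissible_pair d \<gamma> \<sigma> \<and> (\<forall>x. pair_genfun \<gamma> \<sigma> x = egf P x)))"
  proof
    assume "P 0 = 1"
    hence "c = 1" if "\<forall>x. fps_const c * pair_genfun \<gamma> \<sigma> x = egf P x" for c \<gamma> \<sigma>
      using c_eq[OF that] by simp
    hence "(c \<noteq> 0 \<and> admissible_pair d \<gamma> \<sigma> \<and> (\<forall>x. fps_const c * pair_genfun \<gamma> \<sigma> x = egf P x)) \<longleftrightarrow>
        c = 1 \<and> admissible_pair d \<gamma> \<sigma> \<and> (\<forall>x. pair_genfun \<gamma> \<sigma> x = egf P x)" for c \<gamma> \<sigma>
      by (cases "c = 1") auto
    thus "d_orthogonal d P \<and> sheffer P \<longleftrightarrow>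
        (\<exists>\<gamma> \<sigma>. admissible_pair d \<gamma> \<sigma> \<and> (\<forall>x. pair_genfun \<gamma> \<sigma> x = egf P x))"
      unfolding iff by simp
  qed
qed

end
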